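(* For every integer $k \geq 5$ there is $n_0$ such that for all $n \geq n_0$, $s(n, \mathcal{C}_k) \geq \binom{n}{2} - (k-1)(2k-4)[n - (k-1)(2k-3)]$. This holds both when Mini moves first and when Max moves first.
   Context: Let $\mathcal{P}$ be a monotone increasing property of graphs on vertex set $[n]$. An edge $e \in \binom{[n]}{2}\setminus E(G)$ is legal with respect to a graph $G \notin \mathcal{P}$ if $G \cup \{e\} \notin \mathcal{P}$. The saturation game $(n,\mathcal{P})$: starting from the empty graph on $[n]$, two players, Mini and Max, alternately add a legal edge to the current graph $G$. The game ends when no legal edge exists. Max wants to maximize the number of edges of the final graph and Mini wants to minimize it. The score $s(n,\mathcal{P})$ is the number of edges of the final graph under optimal play by both players; it may depend on which player moves first. $\mathcal{C}_k$ denotes the property of being $k$-vertex-connected (on all $n$ vertices). *)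

theory Defs
  imports Complex_Main
begin

text \<open>Finite simple graphs on \<open>{1..n}\<close> are identified with their edge sets, i.e. with subsets
  of the set of two-element subsets of \<open>{1..n}\<close>; a graph property is a predicate on edge sets.\<close>

definition complete_edges :: "nat \<Rightarrow> nat set set" where
  "complete_edges n = {e. e \<subseteq> {1..n} \<and> card e = 2}"

definition legal_edges :: "nat \<Rightarrow> (nat set set \<Rightarrow> bool) \<Rightarrow> nat set set \<Rightarrow> nat set set" where
  "legal_edges n P E = {e \<in> complete_edges n - E. \<not> P (insert e E)}"

lemma finite_complete_edges: "finite (complete_edges n)"
  by (rule finite_subset[of _ "Pow {1..n}"]) (auto simp: complete_edges_def)

datatype player = Player_Mini | Player_Max

text \<open>\<open>game_value n P p E\<close> is the minimax number of edges of the final graph when the current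
  graph is \<open>E\<close> and player \<open>p\<close> is to move.\<close>

function game_value ::
  "nat \<Rightarrow> (nat set set \<Rightarrow> bool) \<Rightarrow> player \<Rightarrow> nat set set \<Rightarrow> nat" where
  "game_value n P Player_Mini E =
     (if legal_edges n P E = {} then card E
      else Min ((\<lambda>e. game_value n P Player_Max (insert e E)) ` legal_edges n P E))"
| "game_value n P Player_Max E =
     (if legal_edges n P E = {} then card E
      else Max ((\<lambda>e. game_value n P Player_Mini (insert e E)) ` legal_edges n P E))"
  by pat_completeness auto
termination
proof (relation "measure (\<lambda>(n, P, p, E). card (complete_edges n - E))", goal_cases)
  case 1
  show ?case by simp
next
  case (2 n P E e)
  then have "e \<in> complete_edges n - E" by (auto simp: legal_edges_def)
  then have "complete_edges n - insert e E \<subset> complete_edges n - E" by auto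
  then show ?case by (simp add: psubset_card_mono finite_complete_edges)
next
  case (3 n P E e)
  then have "e \<in> complete_edges n - E" by (auto simp: legal_edges_def)
  then have "complete_edges n - insert e E \<subset> complete_edges n - E" by auto
  then show ?case by (simp add: psubset_card_mono finite_complete_edges)
qed

declare game_value.simps [simp del]

definition saturation_score :: "nat \<Rightarrow> (nat set set \<Rightarrow> bool) \<Rightarrow> player \<Rightarrow> nat" where
  "saturation_score n P first = game_value n P first {}"

definition graph_connected :: "'a set \<Rightarrow> 'a set set \<Rightarrow> bool" where
  "graph_connected V E \<longleftrightarrow>
     V \<noteq> {} \<and> (\<forall>u\<in>V. \<forall>v\<in>V. (u, v) \<in> {(x, y). x \<in> V \<and> y \<in> V \<and> {x, y} \<in> E}\<^sup>*)"

text \<open>Edges of \<open>E\<close> leaving \<open>V - S\<close> are ignored by \<open>graph_connected (V - S) E\<close>, so this is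
  connectedness of the graph with the vertices in \<open>S\<close> deleted.\<close>

definition vertex_connected :: "nat \<Rightarrow> 'a set \<Rightarrow> 'a set set \<Rightarrow> bool" where
  "vertex_connected k V E \<longleftrightarrow>
     k < card V \<and> (\<forall>S. S \<subseteq> V \<and> card S < k \<longrightarrow> graph_connected (V - S) E)"

end

theory Submission
  imports Defs
begin

text \<open>Max fixes in advance a sparse target graph \<open>T\<close> and claims missing edges of \<open>T\<close> until
  \<open>T\<close> is contained in the current graph. \<open>T\<close> consists of a core \<open>{1..m}\<close>, with
  \<open>m\<close> about \<open>n / (2k - 3)\<close>, in which vertices at distance at most \<open>k\<close> are adjacent,
  and of pendant vertices, at most \<open>2k - 4\<close> of them at each core vertex. The edges of \<open>T\<close>
  stay legal throughout, because a \<open>k\<close>-connected graph has minimum degree at least \<open>k\<close>: each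
  pendant vertex is incident with one edge of \<open>T\<close>, so it would need \<open>k - 1\<close> edges outside
  \<open>T\<close>, and Mini has not had enough moves to provide them.

  The final graph is complete up to the missing edges between the two sides of a separation of
  order at most \<open>k - 1\<close>. Such a separation leaves the remaining core vertices on one side, so
  the other side consists of pendant vertices whose core neighbours were deleted; there are at
  most \<open>(k - 1) (2k - 4)\<close> of these.\<close>

section \<open>Claiming a target graph\<close>

lemma finite_legal_edges: "finite (legal_edges n P E)"
  by (rule finite_subset[OF _ finite_complete_edges]) (auto simp: legal_edges_def)

text \<open>Until \<open>T\<close> is complete, each move of Max claims an edge of \<open>T\<close>,
  so edges outside \<open>T\<close> exceed claimed ones by at most one, and only when Max is to
  move. This invariant holds at the empty graph whoever starts. It keeps all missing edges of
  \<open>T\<close> legal, so the game cannot end before \<open>T\<close> is complete.\<close>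

lemma game_value_ge_if_target_claimable:
  assumes T: "T \<subseteq> complete_edges n"
    and claim: "\<And>E e. E \<subseteq> complete_edges n \<Longrightarrow> card (E - T) \<le> card T \<Longrightarrow> e \<in> T - E
      \<Longrightarrow> \<not> P (insert e E)"
    and final: "\<And>E. E \<subseteq> complete_edges n \<Longrightarrow> T \<subseteq> E \<Longrightarrow> \<not> P E \<Longrightarrow> legal_edges n P E = {}
      \<Longrightarrow> b \<le> card E"
    and E: "E \<subseteq> complete_edges n" "\<not> P E"
    and inv: "T \<subseteq> E \<or> card (E - T) \<le> card (E \<inter> T) + (if p = Player_Max then 1 else 0)"
  shows "b \<le> game_value n P p E"
  using E inv
proof (induction "card (complete_edges n - E)" arbitrary: E p rule: less_induct)
  case less
  have fin: "finite E" "finite T"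
    using less.prems(1) T finite_complete_edges finite_subset by blast+
  have "e \<in> legal_edges n P E" if "e \<in> T - E" for e
  proof -
    \<comment> \<open>A missing edge makes the inclusion strict, which absorbs the extra one in the
      invariant.\<close>
    have "E \<inter> T \<subset> T" using that by auto
    then have "card (E \<inter> T) < card T" using fin by (simp add: psubset_card_mono)
    then have "card (E - T) \<le> card T" using less.prems(3) that by (auto split: if_splits)
    then show ?thesis using claim[OF less.prems(1)] that T by (auto simp: legal_edges_def)
  qed
  then have target: "T - E \<subseteq> legal_edges n P E" by blast
  have step: "b \<le> game_value n P p' (insert e E)"
    if "e \<in> legal_edges n P E"
      and "T \<subseteq> insert e E \<or>
        card (insert e E - T) \<le> card (insert e E \<inter> T) + (if p' = Player_Max then 1 else 0)"
    for e p'
  proof (rule less.hyps[OF _ _ _ that(2)])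
    have "complete_edges n - insert e E \<subset> complete_edges n - E"
      using that(1) by (auto simp: legal_edges_def)
    then show "card (complete_edges n - insert e E) < card (complete_edges n - E)"
      by (simp add: psubset_card_mono finite_complete_edges)
  qed (use that(1) less.prems(1) in \<open>auto simp: legal_edges_def\<close>)
  show ?case
  proof (cases "legal_edges n P E = {}")
    case True
    then have "b \<le> card E" using target final less.prems by blast
    then show ?thesis using True by (cases p) (simp_all add: game_value.simps)
  next
    case False
    show ?thesis
    proof (cases p)
      case Player_Mini
      have "b \<le> game_value n P Player_Max (insert e E)" if e: "e \<in> legal_edges n P E" for e
      proof (rule step[OF e])
        have "card (insert e E - T) \<le> Suc (card (E - T))"
          using fin by (simp add: insert_Diff_if card_insert_if)
        moreover have "card (E \<inter> T) \<le> card (insert e E \<inter> T)"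
          using fin by (intro card_mono) auto
        ultimately show "T \<subseteq> insert e E \<or> card (insert e E - T) \<le>
            card (insert e E \<inter> T) + (if Player_Max = Player_Max then 1 else 0)"
          using less.prems(3) unfolding Player_Mini by auto
      qed
      then show ?thesis using False Player_Mini
        by (simp add: game_value.simps(1)[of n P E] finite_legal_edges)
    next
      case Player_Max
      have "\<exists>e \<in> legal_edges n P E. b \<le> game_value n P Player_Mini (insert e E)"
      proof (cases "T \<subseteq> E")
        \<comment> \<open>Once \<open>T\<close> is complete it remains so, and any legal edge
          serves.\<close>
        case True
        then show ?thesis using False step by blast
      next
        case notsub: False
        then obtain e where e: "e \<in> T - E" by auto
        have "insert e E - T = E - T" "insert e E \<inter> T = insert e (E \<inter> T)" using e by auto
        then have "card (insert e E - T) \<le> card (insert e E \<inter> T)"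
          using less.prems(3) Player_Max e notsub fin by auto
        then show ?thesis using step[of e Player_Mini] e target by auto
      qed
      then show ?thesis using False Player_Max
        by (auto simp: game_value.simps(2)[of n P E] finite_legal_edges Max_ge_iff)
    qed
  qed
qed

section \<open>Separations and degrees\<close>

lemma graph_connected_no_separation:
  assumes "graph_connected V E" "V = A \<union> B" "A \<noteq> {}" "B \<noteq> {}" "A \<inter> B = {}"
  shows "\<exists>x\<in>A. \<exists>y\<in>B. {x, y} \<in> E"
proof (rule ccontr)
  assume no: "\<not> ?thesis"
  obtain a b where ab: "a \<in> A" "b \<in> B" using assms by auto
  then have "(a, b) \<in> {(x, y). x \<in> V \<and> y \<in> V \<and> {x, y} \<in> E}\<^sup>*"
    using assms by (auto simp: graph_connected_def)
  then have "b \<in> A"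
    by (induction rule: rtrancl_induct) (use ab no assms in auto)
  then show False using ab assms by auto
qed

lemma not_vertex_connected_separation:
  assumes "\<not> vertex_connected k V E" "k < card V"
  obtains S A B where "S \<subseteq> V" "card S < k" "V - S = A \<union> B" "A \<inter> B = {}" "A \<noteq> {}" "B \<noteq> {}"
    "\<And>x y. x \<in> A \<Longrightarrow> y \<in> B \<Longrightarrow> {x, y} \<notin> E"
proof -
  obtain S where S: "S \<subseteq> V" "card S < k" "\<not> graph_connected (V - S) E"
    using assms by (auto simp: vertex_connected_def)
  \<comment> \<open>\<open>graph_connected\<close> is false on the empty set, so this case has to be
    excluded before two separated vertices can be chosen.\<close>
  have "V - S \<noteq> {}"
    using S assms(2) by (metis Diff_eq_empty_iff dual_order.antisym less_asym)
  define R where "R = {(x, y). x \<in> V - S \<and> y \<in> V - S \<and> {x, y} \<in> E}"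
  obtain u v where uv: "u \<in> V - S" "v \<in> V - S" "(u, v) \<notin> R\<^sup>*"
    using S \<open>V - S \<noteq> {}\<close> unfolding graph_connected_def R_def by blast
  define A where "A = {x \<in> V - S. (u, x) \<in> R\<^sup>*}"
  show ?thesis
  proof (rule that[of S A "V - S - A"])
    show "{x, y} \<notin> E" if "x \<in> A" "y \<in> V - S - A" for x y
    proof
      assume "{x, y} \<in> E"
      then have "(x, y) \<in> R" using that by (auto simp: R_def A_def)
      then have "y \<in> A" using that by (auto simp: A_def intro: rtrancl_into_rtrancl)
      then show False using that by auto
    qed
  qed (use S uv in \<open>auto simp: A_def\<close>)
qed

lemma not_vertex_connectedI_separation:
  assumes "S \<subseteq> V" "card S < k" "V - S = A \<union> B" "A \<inter> B = {}" "A \<noteq> {}" "B \<noteq> {}"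
    "\<And>x y. x \<in> A \<Longrightarrow> y \<in> B \<Longrightarrow> {x, y} \<notin> E"
  shows "\<not> vertex_connected k V E"
proof
  assume "vertex_connected k V E"
  then have "graph_connected (V - S) E" using assms by (auto simp: vertex_connected_def)
  from graph_connected_no_separation[OF this assms(3,5,6,4)] show False using assms(7) by blast
qed

text \<open>Fewer than \<open>k\<close> neighbours would form a cut isolating \<open>v\<close>,
  since \<open>k < card V\<close> leaves some further vertex.\<close>

lemma vertex_connected_degree_ge:
  assumes conn: "vertex_connected k V E" and v: "v \<in> V"
  shows "k \<le> card {u \<in> V - {v}. {v, u} \<in> E}"
proof (rule ccontr)
  let ?N = "{u \<in> V - {v}. {v, u} \<in> E}"
  assume "\<not> k \<le> card ?N"
  then have small: "card ?N < k" by simp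
  have "k < card V" using conn by (simp add: vertex_connected_def)
  then have "finite V" using card.infinite by fastforce
  have "card (insert v ?N) \<le> k"
    using small \<open>finite V\<close> by simp
  then have "\<not> V \<subseteq> insert v ?N"
    using \<open>k < card V\<close> \<open>finite V\<close> card_mono[of "insert v ?N" V] by auto
  then have rest: "V - insert v ?N \<noteq> {}" by blast
  have split: "V - ?N = {v} \<union> (V - insert v ?N)" using v by blast
  have "\<not> vertex_connected k V E"
    by (rule not_vertex_connectedI_separation[OF _ small split _ _ rest]) auto
  then show False using conn by contradiction
qed

text \<open>Double counting: an edge contributes once for each of its endpoints in
  \<open>L\<close>.\<close>

lemma sum_incidences_le:
  assumes "finite F" "finite L" "\<And>f. f \<in> F \<Longrightarrow> card f = 2"
  shows "(\<Sum>v\<in>L. card {f \<in> F. v \<in> f}) \<le> 2 * card F"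
proof -
  have "(\<Sum>v\<in>L. card {f \<in> F. v \<in> f}) = (\<Sum>v\<in>L. \<Sum>f\<in>F. if v \<in> f then 1 else 0)"
    using assms by (simp add: sum.If_cases Int_def)
  also have "\<dots> = (\<Sum>f\<in>F. \<Sum>v\<in>L. if v \<in> f then 1 else 0)" by (rule sum.swap)
  also have "\<dots> = (\<Sum>f\<in>F. card (L \<inter> f))"
    using assms by (simp add: sum.If_cases)
  also have "\<dots> \<le> (\<Sum>f\<in>F. 2)"
  proof (rule sum_mono)
    fix f assume "f \<in> F"
    then have "card f = 2" using assms by auto
    then show "card (L \<inter> f) \<le> 2"
      using card_mono[of f "L \<inter> f"] by (metis card.infinite inf_le2 zero_neq_numeral)
  qed
  finally show ?thesis by simp
qed

lemma card_complete_edges: "card (complete_edges n) = n choose 2"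
  using n_subsets[of "{1..n}" 2] by (simp add: complete_edges_def)

text \<open>A missing edge that does not run between \<open>A\<close> and \<open>B\<close> would
  leave the separation intact and hence be legal, so in a saturated graph all missing edges run
  between the two sides.\<close>

lemma saturated_separation:
  assumes E: "E \<subseteq> complete_edges n" and n: "k < n"
    and "\<not> vertex_connected k {1..n} E"
    and sat: "legal_edges n (vertex_connected k {1..n}) E = {}"
  obtains S A B where "S \<subseteq> {1..n}" "card S < k" "{1..n} - S = A \<union> B" "A \<inter> B = {}"
    "\<And>x y. x \<in> A \<Longrightarrow> y \<in> B \<Longrightarrow> {x, y} \<notin> E"
    "n choose 2 \<le> card E + card A * card B"
proof -
  obtain S A B where S: "S \<subseteq> {1..n}" "card S < k" "{1..n} - S = A \<union> B" "A \<inter> B = {}"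
    "A \<noteq> {}" "B \<noteq> {}" and no: "\<And>x y. x \<in> A \<Longrightarrow> y \<in> B \<Longrightarrow> {x, y} \<notin> E"
    using not_vertex_connected_separation[OF assms(3)] n by auto
  let ?X = "(\<lambda>(x, y). {x, y}) ` (A \<times> B)"
  have "finite (A \<union> B)" using S(3) by (metis finite_Diff finite_atLeastAtMost)
  then have fin: "finite A" "finite B" by auto
  have "complete_edges n \<subseteq> E \<union> ?X"
  proof
    fix e assume e: "e \<in> complete_edges n"
    show "e \<in> E \<union> ?X"
    proof (rule ccontr)
      assume not: "e \<notin> E \<union> ?X"
      then have "{x, y} \<notin> insert e E" if "x \<in> A" "y \<in> B" for x y
        using no that by fastforce
      then have "\<not> vertex_connected k {1..n} (insert e E)"
        using not_vertex_connectedI_separation[OF S] by blast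
      then show False using sat e not by (auto simp: legal_edges_def)
    qed
  qed
  then have "card (complete_edges n) \<le> card (E \<union> ?X)"
    using E fin finite_subset[OF E finite_complete_edges] by (intro card_mono) auto
  also have "\<dots> \<le> card E + card ?X" by (rule card_Un_le)
  also have "\<dots> \<le> card E + card A * card B"
    using card_image_le[of "A \<times> B" "\<lambda>(x, y). {x, y}"] fin by (simp add: card_cartesian_product)
  finally show ?thesis using that[OF S(1-4) no] by (simp add: card_complete_edges)
qed

section \<open>The target graph\<close>

text \<open>The vertices after \<open>m\<close> are cut into consecutive blocks of length
  \<open>q\<close>, and the \<open>i\<close>-th block hangs at core vertex \<open>i\<close>.\<close>

definition pendant_parent :: "nat \<Rightarrow> nat \<Rightarrow> nat \<Rightarrow> nat" where
  "pendant_parent m q v = (v - m - 1) div q + 1"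

text \<open>This is the \<open>k\<close>-th power of a path: it has only linearly many edges, yet
  deleting fewer than \<open>k\<close> vertices cannot disconnect what remains.\<close>

definition core_edges :: "nat \<Rightarrow> nat \<Rightarrow> nat set set" where
  "core_edges k m = {{i, j} |i j. 1 \<le> i \<and> i < j \<and> j \<le> m \<and> j \<le> i + k}"

definition pendant_edges :: "nat \<Rightarrow> nat \<Rightarrow> nat \<Rightarrow> nat set set" where
  "pendant_edges m q n = (\<lambda>v. {v, pendant_parent m q v}) ` {m + 1..n}"

definition target_graph :: "nat \<Rightarrow> nat \<Rightarrow> nat \<Rightarrow> nat \<Rightarrow> nat set set" where
  "target_graph k m q n = core_edges k m \<union> pendant_edges m q n"

lemma pendant_parent_in_core:
  assumes "v \<in> {m + 1..n}" "n \<le> m * (q + 1)"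
  shows "pendant_parent m q v \<in> {1..m}"
proof -
  have "v - m - 1 < m * q" using assms by auto
  then have "(v - m - 1) div q < m" by (simp add: less_mult_imp_div_less)
  then show ?thesis by (simp add: pendant_parent_def)
qed

lemma card_pendants_le:
  assumes "0 < q"
  shows "card {v \<in> {m + 1..n}. pendant_parent m q v = i} \<le> q"
proof -
  have "{v \<in> {m + 1..n}. pendant_parent m q v = i} \<subseteq> {m + 1 + (i - 1) * q..<m + 1 + (i - 1) * q + q}"
  proof
    fix v assume v: "v \<in> {v \<in> {m + 1..n}. pendant_parent m q v = i}"
    define w where "w = v - m - 1"
    have w: "v = m + 1 + w" "w div q = i - 1"
      using v by (auto simp: w_def pendant_parent_def)
    have "w = w div q * q + w mod q" "w mod q < q" using assms by auto
    then show "v \<in> {m + 1 + (i - 1) * q..<m + 1 + (i - 1) * q + q}" using w by auto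
  qed
  then show ?thesis using card_mono[of "{m + 1 + (i - 1) * q..<m + 1 + (i - 1) * q + q}"] by simp
qed

lemma target_graph_subset:
  assumes "m \<le> n" "n \<le> m * (q + 1)"
  shows "target_graph k m q n \<subseteq> complete_edges n"
proof
  fix e assume "e \<in> target_graph k m q n"
  then consider i j where "e = {i, j}" "1 \<le> i" "i < j" "j \<le> m"
    | v where "v \<in> {m + 1..n}" "e = {v, pendant_parent m q v}"
    by (auto simp: target_graph_def core_edges_def pendant_edges_def)
  then show "e \<in> complete_edges n"
  proof cases
    case 1
    then show ?thesis using assms by (auto simp: complete_edges_def)
  next
    case 2
    have p: "pendant_parent m q v \<in> {1..m}" using pendant_parent_in_core[OF 2(1) assms(2)] .
    then have "v \<noteq> pendant_parent m q v" using 2(1) by auto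
    then show ?thesis using p 2 assms(1) by (auto simp: complete_edges_def)
  qed
qed

lemma card_target_graph_le: "card (target_graph k m q n) \<le> m * k + (n - m)"
proof -
  \<comment> \<open>A core edge is encoded by its smaller endpoint and its length; pairs reaching
    past \<open>m\<close> only enlarge the image.\<close>
  have "core_edges k m \<subseteq> (\<lambda>(i, d). {i, i + d}) ` ({1..m} \<times> {1..k})"
  proof
    fix e assume "e \<in> core_edges k m"
    then obtain i j where "e = {i, j}" "1 \<le> i" "i < j" "j \<le> m" "j \<le> i + k"
      by (auto simp: core_edges_def)
    then show "e \<in> (\<lambda>(i, d). {i, i + d}) ` ({1..m} \<times> {1..k})"
      by (intro image_eqI[of _ _ "(i, j - i)"]) auto
  qed
  then have "card (core_edges k m) \<le> card ({1..m} \<times> {1..k})"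
    by (rule surj_card_le[rotated]) simp
  moreover have "card (pendant_edges m q n) \<le> n - m"
    unfolding pendant_edges_def using card_image_le[of "{m + 1..n}"] by (metis add_diff_cancel_right
        card_atLeastAtMost diff_diff_left finite_atLeastAtMost Suc_eq_plus1)
  ultimately show ?thesis
    using card_Un_le[of "core_edges k m" "pendant_edges m q n"]
    by (simp add: target_graph_def)
qed

lemma target_edge_at_pendant:
  assumes "f \<in> target_graph k m q n" "v \<in> f" "v \<in> {m + 1..n}" "n \<le> m * (q + 1)"
  shows "f = {v, pendant_parent m q v}"
proof -
  have "f \<notin> core_edges k m" using assms(2,3) by (auto simp: core_edges_def)
  then obtain u where u: "u \<in> {m + 1..n}" "f = {u, pendant_parent m q u}"
    using assms(1) by (auto simp: target_graph_def pendant_edges_def)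
  then have "v \<noteq> pendant_parent m q u"
    using pendant_parent_in_core[OF u(1) assms(4)] assms(3) by auto
  then show ?thesis using u assms(2) by auto
qed

section \<open>Legality of the target edges\<close>

text \<open>If the new graph were \<open>k\<close>-connected, each of the \<open>n - m\<close>
  pendant vertices would have at least \<open>k - 1\<close> edges outside the target. Counting
  incidences gives \<open>(k - 1) * (n - m)\<close> at most twice the size of the target, contrary
  to \<open>room\<close>.\<close>

lemma target_edge_legal:
  assumes n: "m \<le> n" "n \<le> m * (q + 1)"
    and E: "E \<subseteq> complete_edges n" and e: "e \<in> target_graph k m q n"
    and few: "card (E - target_graph k m q n) \<le> card (target_graph k m q n)"
    and room: "3 * (n - m) + 2 * (m * k) < k * (n - m)"
  shows "\<not> vertex_connected k {1..n} (insert e E)"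
proof
  assume conn: "vertex_connected k {1..n} (insert e E)"
  let ?T = "target_graph k m q n" and ?L = "{m + 1..n}"
  let ?F = "E - ?T"
  have finF: "finite ?F" using E finite_complete_edges finite_subset by blast
  \<comment> \<open>The 1 stands for the only target edge at \<open>v\<close>; it also covers
    \<open>e\<close>, which lies in the target.\<close>
  have deg: "k \<le> 1 + card {f \<in> ?F. v \<in> f}" if v: "v \<in> ?L" for v
  proof -
    let ?N = "{u \<in> {1..n} - {v}. {v, u} \<in> insert e E}"
    have fin: "finite {f \<in> ?F. v \<in> f}" by (rule finite_subset[OF _ finF]) blast
    have "k \<le> card ?N" using vertex_connected_degree_ge[OF conn, of v] v by simp
    also have "\<dots> = card ((\<lambda>u. {v, u}) ` ?N)"
      by (rule card_image[symmetric]) (auto simp: inj_on_def doubleton_eq_iff)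
    also have "\<dots> \<le> card (insert {v, pendant_parent m q v} {f \<in> ?F. v \<in> f})"
    proof (rule card_mono)
      show "finite (insert {v, pendant_parent m q v} {f \<in> ?F. v \<in> f})" using fin by simp
      show "(\<lambda>u. {v, u}) ` ?N \<subseteq> insert {v, pendant_parent m q v} {f \<in> ?F. v \<in> f}"
        using e target_edge_at_pendant[OF _ _ v n(2), where k = k] by auto
    qed
    also have "\<dots> \<le> 1 + card {f \<in> ?F. v \<in> f}"
      using card_insert_if[OF fin] by simp
    finally show ?thesis .
  qed
  have "k * (n - m) = (\<Sum>v\<in>?L. k)" by simp
  also have "\<dots> \<le> (\<Sum>v\<in>?L. 1 + card {f \<in> ?F. v \<in> f})" by (rule sum_mono) (rule deg)
  also have "\<dots> = (n - m) + (\<Sum>v\<in>?L. card {f \<in> ?F. v \<in> f})"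
    by (simp only: sum.distrib) simp
  also have "\<dots> \<le> (n - m) + 2 * card ?F"
    using sum_incidences_le[OF finF, of ?L] E by (auto simp: complete_edges_def)
  also have "\<dots> \<le> (n - m) + 2 * (m * k + (n - m))"
    using order_trans[OF few card_target_graph_le] by simp
  finally show False using room by simp
qed

section \<open>Separations of a graph containing the target\<close>

text \<open>Take core vertices \<open>i < j\<close> on opposite sides. If all vertices between them
  are deleted, there are fewer than \<open>k\<close> of them, so \<open>i\<close> and
  \<open>j\<close> are adjacent across the separation. Otherwise a surviving vertex between them is
  opposite to one of the two, at a smaller distance.\<close>

lemma core_on_one_side:
  fixes S A B :: "nat set"
  assumes "finite S" "card S < k" "{1..m} \<subseteq> S \<union> A \<union> B" "A \<inter> B = {}"
    and core: "core_edges k m \<subseteq> E"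
    and no: "\<And>x y. x \<in> A \<Longrightarrow> y \<in> B \<Longrightarrow> {x, y} \<notin> E"
  shows "{1..m} \<inter> A = {} \<or> {1..m} \<inter> B = {}"
proof -
  have adj: "{i, j} \<in> E" if "1 \<le> i" "i < j" "j \<le> m" "j \<le> i + k" for i j
    using that core by (auto simp: core_edges_def)
  have apart: False if "1 \<le> i" "i < j" "j \<le> m" "i \<in> A \<and> j \<in> B \<or> i \<in> B \<and> j \<in> A" for i j
    using that
  proof (induction "j - i" arbitrary: i j rule: less_induct)
    case less
    show ?case
    proof (cases "{i<..<j} \<subseteq> S")
      case True
      then have "card {i<..<j} \<le> card S" using assms(1) by (rule card_mono[rotated])
      then have "j \<le> i + k" using assms(2) by simp
      then show ?thesis using adj[OF less.prems(1-3)] no less.prems(4) by (metis insert_commute)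
    next
      case False
      then obtain l where l: "i < l" "l < j" "l \<notin> S"
        by (meson greaterThanLessThan_iff subsetI)
      have left: "\<not> (i \<in> A \<and> l \<in> B \<or> i \<in> B \<and> l \<in> A)"
        using less.hyps[of l i] l less.prems(1-3)
        by (meson diff_less_mono less_imp_le less_le_trans order.refl)
      have right: "\<not> (l \<in> A \<and> j \<in> B \<or> l \<in> B \<and> j \<in> A)"
        using less.hyps[of j l] l less.prems(1-3)
        by (meson diff_less_mono2 less_imp_le le_trans less_trans)
      have "l \<in> {1..m}" using less.prems l by auto
      then have "l \<in> A \<or> l \<in> B" using assms(3) l(3) by blast
      then show ?thesis using left right less.prems(4) by blast
    qed
  qed
  have False if "i \<in> {1..m} \<inter> A" "j \<in> {1..m} \<inter> B" for i j
  proof -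
    have "i \<noteq> j" using that assms(4) by auto
    then show False using apart[of i j] apart[of j i] that by (cases i j rule: linorder_cases) auto
  qed
  then show ?thesis by blast
qed

text \<open>Every vertex of \<open>A\<close> is pendant. Its parent is in the core, hence not in
  \<open>A\<close>, and is adjacent to it, hence not in \<open>B\<close>; so the parent lies in
  \<open>S\<close>, and each vertex of \<open>S\<close> has at most \<open>q\<close>
  pendants.\<close>

lemma card_side_without_core_le:
  assumes n: "n \<le> m * (q + 1)" and q: "0 < q"
    and S: "S \<subseteq> {1..n}" "{1..n} - S = A \<union> B" and mn: "m \<le> n"
    and T: "pendant_edges m q n \<subseteq> E" and core: "{1..m} \<inter> A = {}"
    and no: "\<And>x y. x \<in> A \<Longrightarrow> y \<in> B \<Longrightarrow> {x, y} \<notin> E"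
  shows "card A \<le> card S * q"
proof -
  let ?D = "\<lambda>i. {v \<in> {m + 1..n}. pendant_parent m q v = i}"
  have finS: "finite S" using S(1) finite_subset by blast
  have "A \<subseteq> (\<Union>i\<in>S. ?D i)"
  proof
    fix v assume v: "v \<in> A"
    then have "v \<in> {1..n}" using S by auto
    then have vL: "v \<in> {m + 1..n}" using core v by (auto simp: not_less_eq_eq)
    let ?p = "pendant_parent m q v"
    have p: "?p \<in> {1..m}" using pendant_parent_in_core[OF vL n] .
    have "{v, ?p} \<in> E" using T vL by (auto simp: pendant_edges_def)
    then have "?p \<notin> B" using no v by blast
    moreover have "?p \<notin> A" using core p by blast
    moreover have "?p \<in> {1..n}" using p mn by auto
    ultimately have "?p \<in> S" using S by blast
    then show "v \<in> (\<Union>i\<in>S. ?D i)" using vL by blast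
  qed
  then have "card A \<le> card (\<Union>i\<in>S. ?D i)" using finS by (intro card_mono) auto
  also have "\<dots> \<le> (\<Sum>i\<in>S. card (?D i))" using finS by (rule card_UN_le)
  also have "\<dots> \<le> (\<Sum>i\<in>S. q)" by (intro sum_mono card_pendants_le q)
  finally show ?thesis by simp
qed

text \<open>Here \<open>c\<close> is the largest possible \<open>a\<close>. For \<open>a < c\<close>
  the crude bound \<open>a * b\<close> at most \<open>(c - 1) * n\<close> suffices once
  \<open>n\<close> is large; \<open>a = c\<close> forces \<open>s = k - 1\<close>, and then equality
  holds.\<close>

lemma missing_edges_le:
  fixes a b s q k n :: nat
  assumes a: "a \<le> s * q" and s: "s < k" and q: "0 < q" and n: "a + b + s = n"
    and c: "c = (k - 1) * q" and large: "c * (k - 1) + c * c \<le> n"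
  shows "a * b + c * (k - 1) + c * c \<le> c * n"
proof (cases "a < c")
  case True
  then have "(a + 1) * n \<le> c * n" by (intro mult_right_mono) auto
  moreover have "a * b \<le> a * n" using n by (intro mult_left_mono) auto
  ultimately show ?thesis using large by (simp only: distrib_right mult_1)
next
  case False
  have "s * q \<le> (k - 1) * q" using s by (intro mult_right_mono) auto
  then have "a = c" "s * q = (k - 1) * q" using False a c by linarith+
  then have "s = k - 1" using q by simp
  then show ?thesis using n \<open>a = c\<close> by (auto simp: algebra_simps)
qed

lemma saturated_card_ge:
  assumes n: "m \<le> n" "n \<le> m * (q + 1)" "k < n" and q: "0 < q"
    and c: "c = (k - 1) * q" and large: "c * (k - 1) + c * c \<le> n"
    and E: "E \<subseteq> complete_edges n" "target_graph k m q n \<subseteq> E"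
    and sat: "\<not> vertex_connected k {1..n} E" "legal_edges n (vertex_connected k {1..n}) E = {}"
  shows "(n choose 2) + c * (k - 1) + c * c \<le> card E + c * n"
proof -
  obtain S A B where S: "S \<subseteq> {1..n}" "card S < k" "{1..n} - S = A \<union> B" "A \<inter> B = {}"
    and no: "\<And>x y. x \<in> A \<Longrightarrow> y \<in> B \<Longrightarrow> {x, y} \<notin> E"
    and card_E: "n choose 2 \<le> card E + card A * card B"
    using saturated_separation[OF E(1) n(3) sat] by blast
  have fin: "finite S" "finite (A \<union> B)"
    using S(1) finite_subset S(3) by (blast, metis finite_Diff finite_atLeastAtMost)
  have "card (A \<union> B) = n - card S"
    using S(1,3) fin by (metis card_Diff_subset card_atLeastAtMost diff_Suc_1)
  moreover have "card S \<le> n" using S(2) n(3) by simp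
  ultimately have cards: "card A + card B + card S = n"
    using card_Un_disjoint[of A B] fin S(4) by auto
  have T: "core_edges k m \<subseteq> E" "pendant_edges m q n \<subseteq> E"
    using E(2) by (auto simp: target_graph_def)
  have "{1..m} \<subseteq> S \<union> A \<union> B" using S(3) n(1) by fastforce
  then have "{1..m} \<inter> A = {} \<or> {1..m} \<inter> B = {}"
    using core_on_one_side[OF fin(1) S(2) _ S(4) T(1) no] by blast
  moreover have "{y, x} \<notin> E" if "y \<in> B" "x \<in> A" for x y
    using no[OF that(2,1)] by (simp add: insert_commute)
  \<comment> \<open>Either side may be the one without core vertices, so the bound is applied with
    \<open>A\<close> and \<open>B\<close> in both orders.\<close>
  ultimately have "card A \<le> card S * q \<or> card B \<le> card S * q"
    using card_side_without_core_le[OF n(2) q S(1,3) n(1) T(2) _ no]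
      card_side_without_core_le[OF n(2) q S(1) S(3)[unfolded Un_commute[of A B]] n(1) T(2)]
    by blast
  then have "card A * card B + c * (k - 1) + c * c \<le> c * n"
    using missing_edges_le[OF _ S(2) q cards c large]
      missing_edges_le[of "card B" "card S" q k "card A" n, OF _ S(2) q _ c large] cards
    by (auto simp: ac_simps)
  then show ?thesis using card_E by linarith
qed

section \<open>Choice of parameters and conclusion\<close>

text \<open>Since \<open>n - m\<close> is at least \<open>(m - 1) * q\<close>, it suffices that
  \<open>(k - 3) * (k - 2) * (m - 1)\<close> exceeds \<open>k * m\<close>. For \<open>k = 5\<close>
  this reads \<open>6 * (m - 1) > 5 * m\<close>, whence the bound 7 on \<open>m\<close>; larger
  \<open>k\<close> leave more room.\<close>

lemma pendant_room:
  fixes k m n q :: nat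
  assumes k: "k \<ge> 5" and q: "q = 2 * k - 4" and m: "7 \<le> m" and n: "m * (q + 1) \<le> n + q"
  shows "3 * (n - m) + 2 * (m * k) < k * (n - m)"
proof -
  obtain j where j: "k = 5 + j" using k le_Suc_ex by blast
  obtain r where r: "m = 7 + r" using m le_Suc_ex by blast
  have q': "q = 6 + 2 * j" using q j by simp
  have "(6 + r) * q \<le> n - m" using n r by (simp add: algebra_simps)
  then have "(2 + j) * ((6 + r) * q) \<le> (2 + j) * (n - m)" by (rule mult_left_mono) simp
  moreover have "2 * (m * k) < (2 + j) * ((6 + r) * q)"
    unfolding r j q' by (simp add: algebra_simps)
  moreover have "k * (n - m) = 3 * (n - m) + (2 + j) * (n - m)"
    unfolding j by (simp only: distrib_right[symmetric]) simp
  ultimately show ?thesis by linarith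
qed

theorem theorem1p2:
  fixes k :: nat
  assumes "k \<ge> 5"
  shows "\<exists>n0::nat. \<forall>n\<ge>n0. \<forall>first::player.
    int (saturation_score n (vertex_connected k {1..n}) first)
      \<ge> int (n choose 2)
         - (int k - 1) * (2 * int k - 4) * (int n - (int k - 1) * (2 * int k - 3))"
proof -
  define q where "q = 2 * k - 4"
  define c where "c = (k - 1) * q"
  \<comment> \<open>The three summands ensure \<open>7 \<le> m\<close>, \<open>k < n\<close> and
    \<open>large\<close>, respectively.\<close>
  define n0 where "n0 = 7 * (q + 1) + (k + 1) + (c * (k - 1) + c * c)"
  have q: "0 < q" using assms by (simp add: q_def)
  have "int (n choose 2)
         - (int k - 1) * (2 * int k - 4) * (int n - (int k - 1) * (2 * int k - 3))
        \<le> int (saturation_score n (vertex_connected k {1..n}) first)"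
    if "n0 \<le> n" for n first
  proof -
    have n: "7 * (q + 1) \<le> n" "k < n" and large: "c * (k - 1) + c * c \<le> n"
      using that by (auto simp: n0_def)
    \<comment> \<open>This is \<open>n / (q + 1)\<close> rounded up, the smallest core that can
      carry the remaining vertices as pendants.\<close>
    define m where "m = (n + q) div (q + 1)"
    have "m * (q + 1) + (n + q) mod (q + 1) = n + q" "(n + q) mod (q + 1) < q + 1"
      unfolding m_def by (simp only: div_mult_mod_eq, simp)
    then have m: "m * (q + 1) \<le> n + q" "n \<le> m * (q + 1)" by linarith+
    have "7 * (q + 1) \<le> m * (q + 1)" using m n by linarith
    then have "7 \<le> m" by (simp only: mult_le_cancel2)
    have "m * 1 + q \<le> m * (q + 1)" using \<open>7 \<le> m\<close> by (cases m) auto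
    then have "m \<le> n" using m by linarith
    let ?P = "vertex_connected k {1..n}"
    \<comment> \<open>As \<open>2 * k - 3 = q + 1\<close>, the product
      \<open>(k - 1) * (2 * k - 3)\<close> equals \<open>c + (k - 1)\<close>, so this is the claimed
      bound expanded, up to truncation at zero.\<close>
    let ?b = "(n choose 2) + c * (k - 1) + c * c - c * n"
    have "?b \<le> game_value n ?P first {}"
    proof (rule game_value_ge_if_target_claimable[where T = "target_graph k m q n"])
      show "target_graph k m q n \<subseteq> complete_edges n"
        by (rule target_graph_subset[OF \<open>m \<le> n\<close> m(2)])
      show "\<not> ?P (insert e E)"
        if "E \<subseteq> complete_edges n" "card (E - target_graph k m q n) \<le> card (target_graph k m q n)"
          "e \<in> target_graph k m q n - E" for E e
        using target_edge_legal[OF \<open>m \<le> n\<close> m(2) that(1) _ that(2)] that(3)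
          pendant_room[OF assms q_def \<open>7 \<le> m\<close> m(1)] by blast
      show "?b \<le> card E"
        if "E \<subseteq> complete_edges n" "target_graph k m q n \<subseteq> E" "\<not> ?P E" "legal_edges n ?P E = {}"
        for E
        using saturated_card_ge[OF \<open>m \<le> n\<close> m(2) n(2) q c_def large that] by simp
      show "\<not> ?P {}"
        using vertex_connected_degree_ge[of k "{1..n}" "{}" 1] assms n by auto
    qed auto
    then have "(n choose 2) + c * (k - 1) + c * c
        \<le> saturation_score n ?P first + c * n"
      by (simp add: saturation_score_def)
    then have "int (n choose 2) + int c * int (k - 1) + int c * int c
        \<le> int (saturation_score n ?P first) + int c * int n"
      by (metis of_nat_add of_nat_le_iff of_nat_mult)
    moreover have "int (k - 1) = int k - 1" "int c = (int k - 1) * (2 * int k - 4)"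
      using assms by (simp_all add: c_def q_def of_nat_diff)
    ultimately show ?thesis by (simp add: algebra_simps)
  qed
  then show ?thesis by blast
qed

end
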